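(* Let $\mathcal{S}$ be an inverse semigroupoid, let $(X,\theta)$ be an $\mathcal{S}$-set, let $(i,E,\eta)$ be the universal globalization of $(X,\theta)$ constructed in the context, and let $(j,Z,\omega)$ be a globalization of $(X,\theta)$. Let $\sigma\colon E\to Z$ be the mediating function given by the universal property of $(i,E,\eta)$, i.e. the unique $\mathcal{S}$-function with $\sigma\circ i=j$. Then, given any $u\in\mathcal{S}^{(0)}$, the function $\sigma$ is injective on $E_u$.
   Context: A semigroupoid is a quintuple $(\mathcal{S},\mathcal{S}^{(0)},d,c,\mu)$ where $\mathcal{S}$ (arrows) and $\mathcal{S}^{(0)}$ (objects) are sets, $d,c\colon\mathcal{S}\to\mathcal{S}^{(0)}$ are maps (domain and codomain), and $\mu\colon\mathcal{S}^{(2)}\to\mathcal{S}$, $\mu(s,t)=st$, is a map defined on the set of composable pairs $\mathcal{S}^{(2)}=\{(s,t)\in\mathcal{S}\times\mathcal{S}: d(s)=c(t)\}$, such that $d(st)=d(t)$ and $c(st)=c(s)$ for all $(s,t)\in\mathcal{S}^{(2)}$, and $(ps)t=p(st)$ whenever $(p,s),(s,t)\in\mathcal{S}^{(2)}$. (Identities are not required.) A semigroupoid $\mathcal{S}$ is an inverse semigroupoid if for every $s\in\mathcal{S}$ there is a unique $s^*\in\mathcal{S}$ with $(s,s^* ),(s^*,s)\in\mathcal{S}^{(2)}$, $ss^*s=s$ and $s^*ss^*=s^*$. The set of idempotents is $E(\mathcal{S})=\{e\in\mathcal{S}:(e,e)\in\mathcal{S}^{(2)},\ ee=e\}$. A partial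 action $\theta$ of an inverse semigroupoid $\mathcal{S}$ on a set $X$ is a pair $\theta=(\{X_s\}_{s\in\mathcal{S}},\{\theta_s\}_{s\in\mathcal{S}})$ of a collection of subsets $X_s\subseteq X$ and a collection of maps $\theta_s\colon X_{s^*}\to X_s$ such that: (P1) $\theta_e=\mathrm{id}_{X_e}$ for all $e\in E(\mathcal{S})$, and for all $x\in X$ there is $e\in E(\mathcal{S})$ with $x\in X_e$; (P2) $X_s\subseteq X_{ss^*}$ for every $s\in\mathcal{S}$; (P3) $\theta_t^{-1}(X_t\cap X_{s^*})=X_{(st)^*}\cap X_{t^*}$ for all $(s,t)\in\mathcal{S}^{(2)}$, and $\theta_s(\theta_t(x))=\theta_{st}(x)$ for all $x\in X_{(st)^*}\cap X_{t^*}$. It is a global action if moreover (P4) $X_s=X_{ss^*}$ for every $s\in\mathcal{S}$. An $\mathcal{S}$-set is a pair $(X,\theta)$ with $\theta$ a partial action of $\mathcal{S}$ on the set $X$; it is a global $\mathcal{S}$-set if $\theta$ is a global action. For $\mathcal{S}$-sets $(X,\theta^X)$ and $(Y,\theta^Y)$, a function $\varphi\colon X\to Y$ is an $\mathcal{S}$-function if $\varphi(X_s)\subseteq Y_s$ for every $s\in\mathcal{S}$ and $\varphi(\theta^X_s(x))=\theta^Y_s(\varphi(x))$ for every $s\in\mathcal{S}$ and $x\in X_{s^*}$. An injective $\mathcal{S}$-function $\varphi\colon X\to Y$ is an embedding if $X_s=\varphi^{-1}\big(\theta^Y_s(\varphi(X)\cap Y_{s^*})\big)$ for every $s\in\mathcal{S}$.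 A triple $(\varphi,Y,\theta^Y)$, with $\varphi\colon X\to Y$ an $\mathcal{S}$-function, is a globalization of $(X,\theta^X)$ if $\varphi$ is an embedding and $(Y,\theta^Y)$ is a global $\mathcal{S}$-set. It is a universal globalization if it is a globalization and for any globalization $(\psi,Z,\theta^Z)$ of $(X,\theta^X)$ there exists a unique $\mathcal{S}$-function $\sigma\colon Y\to Z$ (the mediating function) with $\sigma\circ\varphi=\psi$. Construction of $(i,E,\eta)$ for an $\mathcal{S}$-set $(X,\theta)$. Let $D=\{(s,x)\in\mathcal{S}\times X: x\in X_{s^*s}\}$. For $(s,x),(t,y)\in D$ write $(s,x)\sim(t,y)$ if either (R1) $(t^*,s)\in\mathcal{S}^{(2)}$, $x\in X_{s^*t}$ and $\theta_{t^*s}(x)=y$; or (R2) $s,t\in E(\mathcal{S})$ and $x=y$. Let $\approx$ be the smallest equivalence relation on $D$ containing $\sim$, let $E=D/{\approx}$, and write $[s,x]$ for the class of $(s,x)$. For $s\in\mathcal{S}$ let $D_{s^*}=\{(p,x)\in D:(s,p)\in\mathcal{S}^{(2)},\ x\in X_{p^*s^*sp}\}$, let $E_s$ be the image of $D_s$ in $E$, and let $\eta_s\colon E_{s^*}\to E_s$ be the (well-defined) map with $\eta_s([p,x])=[sp,x]$ for $(p,x)\in D_{s^*}$. Put $\eta=(\{E_s\}_{s\in\mathcal{S}},\{\eta_s\}_{s\in\mathcal{S}})$ and define $i\colon X\to E$ by $i(x)=[e,x]$ for any $e\in E(\mathcal{S})$ with $x\in X_e$ (independent of the choice of $e$). The triple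 $(i,E,\eta)$ is a universal globalization of $(X,\theta)$. For $u\in\mathcal{S}^{(0)}$, let $D_u=\{(s,x)\in D: c(s)=u\}$ and let $E_u$ be the image of $D_u$ under the quotient map $D\to E$. *)

theory Defs
  imports Main "HOL-Library.FuncSet"
begin

section \<open>Inverse semigroupoids\<close>

text \<open>The product is a total function of the logic; only its values on composable pairs are
  constrained or used.\<close>

record ('s, 'o) semigroupoid =
  arrows :: "'s set"
  objects :: "'o set"
  src :: "'s \<Rightarrow> 'o"
  tgt :: "'s \<Rightarrow> 'o"
  mult :: "'s \<Rightarrow> 's \<Rightarrow> 's" (infixl "\<cdot>\<index>" 70)

definition composable :: "('s, 'o, 'm) semigroupoid_scheme \<Rightarrow> ('s \<times> 's) set" where
  "composable S = {(s, t). s \<in> arrows S \<and> t \<in> arrows S \<and> src S s = tgt S t}"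

definition is_semigroupoid :: "('s, 'o, 'm) semigroupoid_scheme \<Rightarrow> bool" where
  "is_semigroupoid S \<longleftrightarrow>
     src S \<in> arrows S \<rightarrow> objects S \<and>
     tgt S \<in> arrows S \<rightarrow> objects S \<and>
     (\<forall>(s, t) \<in> composable S.
        s \<cdot>\<^bsub>S\<^esub> t \<in> arrows S \<and> src S (s \<cdot>\<^bsub>S\<^esub> t) = src S t \<and> tgt S (s \<cdot>\<^bsub>S\<^esub> t) = tgt S s) \<and>
     (\<forall>p s t. (p, s) \<in> composable S \<and> (s, t) \<in> composable S \<longrightarrow>
        (p \<cdot>\<^bsub>S\<^esub> s) \<cdot>\<^bsub>S\<^esub> t = p \<cdot>\<^bsub>S\<^esub> (s \<cdot>\<^bsub>S\<^esub> t))"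

definition is_inverse :: "('s, 'o, 'm) semigroupoid_scheme \<Rightarrow> 's \<Rightarrow> 's \<Rightarrow> bool" where
  "is_inverse S s t \<longleftrightarrow>
     t \<in> arrows S \<and> (s, t) \<in> composable S \<and> (t, s) \<in> composable S \<and>
     s \<cdot>\<^bsub>S\<^esub> t \<cdot>\<^bsub>S\<^esub> s = s \<and> t \<cdot>\<^bsub>S\<^esub> s \<cdot>\<^bsub>S\<^esub> t = t"

definition inverse_semigroupoid :: "('s, 'o, 'm) semigroupoid_scheme \<Rightarrow> bool" where
  "inverse_semigroupoid S \<longleftrightarrow>
     is_semigroupoid S \<and> (\<forall>s \<in> arrows S. \<exists>!t. is_inverse S s t)"

definition star :: "('s, 'o, 'm) semigroupoid_scheme \<Rightarrow> 's \<Rightarrow> 's" where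
  "star S s = (THE t. is_inverse S s t)"

definition idempotents :: "('s, 'o, 'm) semigroupoid_scheme \<Rightarrow> 's set" where
  "idempotents S = {e. (e, e) \<in> composable S \<and> e \<cdot>\<^bsub>S\<^esub> e = e}"


section \<open>Partial actions\<close>

text \<open>In a structure \<open>X\<close>, the subset called $X_s$ is \<open>region X s\<close>, and the map
  $\theta_s \colon X_{s^*} \to X_s$ is \<open>act X s\<close>, whose values matter only on
  \<open>region X (star S s)\<close>.\<close>

record ('s, 'x) action_data =
  points :: "'x set"
  region :: "'s \<Rightarrow> 'x set"
  act :: "'s \<Rightarrow> 'x \<Rightarrow> 'x"

definition S_set :: "('s, 'o, 'm) semigroupoid_scheme \<Rightarrow> ('s, 'x, 'n) action_data_scheme \<Rightarrow> bool"
  where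
  "S_set S X \<longleftrightarrow>
     (\<forall>s \<in> arrows S. region X s \<subseteq> points X) \<and>
     (\<forall>s \<in> arrows S. act X s \<in> region X (star S s) \<rightarrow> region X s) \<and>
     (\<forall>e \<in> idempotents S. \<forall>x \<in> region X e. act X e x = x) \<and>
     (\<forall>x \<in> points X. \<exists>e \<in> idempotents S. x \<in> region X e) \<and>
     (\<forall>s \<in> arrows S. region X s \<subseteq> region X (s \<cdot>\<^bsub>S\<^esub> star S s)) \<and>
     (\<forall>(s, t) \<in> composable S.
        {x \<in> region X (star S t). act X t x \<in> region X t \<inter> region X (star S s)}
          = region X (star S (s \<cdot>\<^bsub>S\<^esub> t)) \<inter> region X (star S t) \<and>
        (\<forall>x \<in> region X (star S (s \<cdot>\<^bsub>S\<^esub> t)) \<inter> region X (star S t).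
           act X s (act X t x) = act X (s \<cdot>\<^bsub>S\<^esub> t) x))"

definition global_S_set ::
  "('s, 'o, 'm) semigroupoid_scheme \<Rightarrow> ('s, 'x, 'n) action_data_scheme \<Rightarrow> bool" where
  "global_S_set S X \<longleftrightarrow>
     S_set S X \<and> (\<forall>s \<in> arrows S. region X s = region X (s \<cdot>\<^bsub>S\<^esub> star S s))"

definition S_function ::
  "('s, 'o, 'm) semigroupoid_scheme \<Rightarrow> ('s, 'x, 'n) action_data_scheme \<Rightarrow>
   ('s, 'y, 'k) action_data_scheme \<Rightarrow> ('x \<Rightarrow> 'y) \<Rightarrow> bool" where
  "S_function S X Y \<phi> \<longleftrightarrow>
     \<phi> \<in> points X \<rightarrow> points Y \<and>
     (\<forall>s \<in> arrows S. \<phi> ` region X s \<subseteq> region Y s) \<and>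
     (\<forall>s \<in> arrows S. \<forall>x \<in> region X (star S s). \<phi> (act X s x) = act Y s (\<phi> x))"

definition embedding ::
  "('s, 'o, 'm) semigroupoid_scheme \<Rightarrow> ('s, 'x, 'n) action_data_scheme \<Rightarrow>
   ('s, 'y, 'k) action_data_scheme \<Rightarrow> ('x \<Rightarrow> 'y) \<Rightarrow> bool" where
  "embedding S X Y \<phi> \<longleftrightarrow>
     S_function S X Y \<phi> \<and> inj_on \<phi> (points X) \<and>
     (\<forall>s \<in> arrows S.
        region X s =
          {x \<in> points X. \<phi> x \<in> act Y s ` (\<phi> ` points X \<inter> region Y (star S s))})"

definition globalization ::
  "('s, 'o, 'm) semigroupoid_scheme \<Rightarrow> ('s, 'x, 'n) action_data_scheme \<Rightarrow>
   ('x \<Rightarrow> 'y) \<Rightarrow> ('s, 'y, 'k) action_data_scheme \<Rightarrow> bool" where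
  "globalization S X \<phi> Y \<longleftrightarrow> embedding S X Y \<phi> \<and> global_S_set S Y"

text \<open>The mediating function between two globalizations \<open>(\<phi>, Y)\<close> and \<open>(\<psi>, Z)\<close>. When
  \<open>(\<phi>, Y)\<close> is universal there is exactly one such function on \<open>points Y\<close>; values of \<open>\<sigma>\<close>
  outside \<open>points Y\<close> are irrelevant.\<close>

definition mediating_function ::
  "('s, 'o, 'm) semigroupoid_scheme \<Rightarrow> ('s, 'x, 'n) action_data_scheme \<Rightarrow>
   ('x \<Rightarrow> 'y) \<Rightarrow> ('s, 'y, 'k) action_data_scheme \<Rightarrow>
   ('x \<Rightarrow> 'z) \<Rightarrow> ('s, 'z, 'l) action_data_scheme \<Rightarrow> ('y \<Rightarrow> 'z) \<Rightarrow> bool" where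
  "mediating_function S X \<phi> Y \<psi> Z \<sigma> \<longleftrightarrow>
     S_function S Y Z \<sigma> \<and> (\<forall>x \<in> points X. \<sigma> (\<phi> x) = \<psi> x)"


section \<open>The universal globalization\<close>

definition D_set ::
  "('s, 'o, 'm) semigroupoid_scheme \<Rightarrow> ('s, 'x, 'n) action_data_scheme \<Rightarrow> ('s \<times> 'x) set" where
  "D_set S X = {(s, x). s \<in> arrows S \<and> x \<in> region X (star S s \<cdot>\<^bsub>S\<^esub> s)}"

definition D_sim ::
  "('s, 'o, 'm) semigroupoid_scheme \<Rightarrow> ('s, 'x, 'n) action_data_scheme \<Rightarrow>
   (('s \<times> 'x) \<times> ('s \<times> 'x)) set" where
  "D_sim S X = {((s, x), (t, y)). (s, x) \<in> D_set S X \<and> (t, y) \<in> D_set S X \<and>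
     ((star S t, s) \<in> composable S \<and> x \<in> region X (star S s \<cdot>\<^bsub>S\<^esub> t) \<and>
        act X (star S t \<cdot>\<^bsub>S\<^esub> s) x = y
      \<or> s \<in> idempotents S \<and> t \<in> idempotents S \<and> x = y)}"

definition D_equiv ::
  "('s, 'o, 'm) semigroupoid_scheme \<Rightarrow> ('s, 'x, 'n) action_data_scheme \<Rightarrow>
   (('s \<times> 'x) \<times> ('s \<times> 'x)) set" where
  "D_equiv S X = \<Inter> {R. equiv (D_set S X) R \<and> D_sim S X \<subseteq> R}"

definition D_class ::
  "('s, 'o, 'm) semigroupoid_scheme \<Rightarrow> ('s, 'x, 'n) action_data_scheme \<Rightarrow>
   's \<times> 'x \<Rightarrow> ('s \<times> 'x) set" where
  "D_class S X a = D_equiv S X `` {a}"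

text \<open>\<open>D_star S X s\<close> is the set written $D_{s^*}$, on whose classes $\eta_s$ is defined;
  hence $D_s$ is \<open>D_star S X (star S s)\<close>.\<close>

definition D_star ::
  "('s, 'o, 'm) semigroupoid_scheme \<Rightarrow> ('s, 'x, 'n) action_data_scheme \<Rightarrow> 's \<Rightarrow>
   ('s \<times> 'x) set" where
  "D_star S X s = {(p, x) \<in> D_set S X. (s, p) \<in> composable S \<and>
     x \<in> region X (star S p \<cdot>\<^bsub>S\<^esub> star S s \<cdot>\<^bsub>S\<^esub> s \<cdot>\<^bsub>S\<^esub> p)}"

definition univ_glob ::
  "('s, 'o, 'm) semigroupoid_scheme \<Rightarrow> ('s, 'x, 'n) action_data_scheme \<Rightarrow>
   ('s, ('s \<times> 'x) set) action_data" where
  "univ_glob S X =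
     \<lparr> points = D_set S X // D_equiv S X,
       region = (\<lambda>s. D_class S X ` D_star S X (star S s)),
       act = (\<lambda>s a. THE b. \<exists>p x. (p, x) \<in> D_star S X s \<and>
               a = D_class S X (p, x) \<and> b = D_class S X (s \<cdot>\<^bsub>S\<^esub> p, x)) \<rparr>"

definition univ_incl ::
  "('s, 'o, 'm) semigroupoid_scheme \<Rightarrow> ('s, 'x, 'n) action_data_scheme \<Rightarrow>
   'x \<Rightarrow> ('s \<times> 'x) set" where
  "univ_incl S X x =
     (THE a. \<exists>e \<in> idempotents S. x \<in> region X e \<and> a = D_class S X (e, x))"

definition univ_fibre ::
  "('s, 'o, 'm) semigroupoid_scheme \<Rightarrow> ('s, 'x, 'n) action_data_scheme \<Rightarrow> 'o \<Rightarrow>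
   ('s \<times> 'x) set set" where
  "univ_fibre S X u = D_class S X ` {(s, x) \<in> D_set S X. tgt S s = u}"

end

theory Submission imports Defs begin

text \<open>
  The idea is to compute \<open>\<sigma>\<close> on representatives: it sends the class of \<open>(s, x)\<close> to
  \<^term>\<open>act Z s (j x)\<close>, called the spread of \<open>(s, x)\<close> below. Indeed that class is the image
  under \<open>\<eta>\<^sub>s\<close> of the class of \<open>(s\<^sup>* s, x)\<close>, which is the image of \<open>x\<close> under the canonical
  inclusion, and \<open>\<sigma>\<close> is equivariant and maps that image to \<open>j x\<close>.

  If \<open>(s, x)\<close> and \<open>(t, y)\<close> have the same spread and the same codomain, then \<open>t\<^sup>* s\<close> exists and
  acts on \<open>Z\<close> so as to send \<open>j x\<close> to \<open>j y\<close>. As \<open>j\<close> is an embedding, a transition in \<open>Z\<close>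
  between two points of the image of \<open>j\<close> is already defined in \<open>X\<close>. Hence \<open>t\<^sup>* s\<close> sends \<open>x\<close> to
  \<open>y\<close> in \<open>X\<close>, which is exactly a generating relation (R1), and the two classes coincide
  (\<open>D_equiv_of_spread_eq\<close>). This is the injectivity on each fibre.

  The same argument shows that \<open>\<eta>\<^sub>s\<close> is well defined, without any look at the zigzags that
  generate the equivalence. The spread is constant on classes, because it is compatible with
  both generating relations (\<open>spread_eq_of_D_equiv\<close>); representatives of one class to which
  \<open>\<eta>\<^sub>s\<close> applies have equal spread, so after multiplication by \<open>s\<close> they have equal spread and
  equal codomain, and are therefore equivalent.
\<close>

section \<open>Inverse semigroupoids\<close>

locale inverse_semigroupoid_loc =
  fixes S :: "('s, 'o, 'm) semigroupoid_scheme" (structure)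
  assumes inverse_semigroupoid: "inverse_semigroupoid S"
begin

lemma composable_iff:
  "(s, t) \<in> composable S \<longleftrightarrow> s \<in> arrows S \<and> t \<in> arrows S \<and> src S s = tgt S t"
  by (simp add: composable_def)

lemma mult_closed [simp]:
  assumes "s \<in> arrows S" "t \<in> arrows S" "src S s = tgt S t"
  shows "s \<cdot> t \<in> arrows S" "src S (s \<cdot> t) = src S t" "tgt S (s \<cdot> t) = tgt S s"
proof -
  have "(s, t) \<in> composable S"
    using assms by (simp add: composable_iff)
  then have "s \<cdot> t \<in> arrows S \<and> src S (s \<cdot> t) = src S t \<and> tgt S (s \<cdot> t) = tgt S s"
    using inverse_semigroupoid unfolding inverse_semigroupoid_def is_semigroupoid_def by blast
  then show "s \<cdot> t \<in> arrows S" "src S (s \<cdot> t) = src S t" "tgt S (s \<cdot> t) = tgt S s"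
    by simp_all
qed

lemma mult_assoc [simp]:
  assumes "p \<in> arrows S" "s \<in> arrows S" "t \<in> arrows S" "src S p = tgt S s" "src S s = tgt S t"
  shows "p \<cdot> s \<cdot> t = p \<cdot> (s \<cdot> t)"
proof -
  have "(p, s) \<in> composable S" "(s, t) \<in> composable S"
    using assms by (simp_all add: composable_iff)
  then show ?thesis
    using inverse_semigroupoid unfolding inverse_semigroupoid_def is_semigroupoid_def by blast
qed

lemma is_inverse_star:
  assumes "s \<in> arrows S" shows "is_inverse S s (star S s)"
proof -
  have "\<exists>!t. is_inverse S s t"
    using inverse_semigroupoid assms by (simp add: inverse_semigroupoid_def)
  then show ?thesis
    unfolding star_def by (rule theI')
qed

lemma star_eqI:
  assumes "is_inverse S s t" shows "star S s = t"
proof -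
  have "s \<in> arrows S"
    using assms by (simp add: is_inverse_def composable_iff)
  then have "\<exists>!t. is_inverse S s t"
    using inverse_semigroupoid by (simp add: inverse_semigroupoid_def)
  then show ?thesis
    unfolding star_def using assms by (rule the1_equality)
qed

lemma star_closed [simp]:
  assumes "s \<in> arrows S"
  shows "star S s \<in> arrows S" "src S (star S s) = tgt S s" "tgt S (star S s) = src S s"
  using is_inverse_star [OF assms] by (auto simp: is_inverse_def composable_iff)

lemma mult_star_mult [simp]:
  assumes "s \<in> arrows S"
  shows "s \<cdot> (star S s \<cdot> s) = s" "star S s \<cdot> (s \<cdot> star S s) = star S s"
  using is_inverse_star [OF assms] assms by (auto simp: is_inverse_def composable_iff)

lemma star_star [simp]: "s \<in> arrows S \<Longrightarrow> star S (star S s) = s"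
  by (rule star_eqI) (simp add: is_inverse_def composable_iff)

lemma idempotents_iff:
  "e \<in> idempotents S \<longleftrightarrow> e \<in> arrows S \<and> src S e = tgt S e \<and> e \<cdot> e = e"
  by (auto simp: idempotents_def composable_iff)

lemma star_idempotent: "e \<in> idempotents S \<Longrightarrow> star S e = e"
  by (rule star_eqI) (simp add: is_inverse_def composable_iff idempotents_iff)

lemma star_mult_idempotent:
  assumes s: "s \<in> arrows S" shows "star S s \<cdot> s \<in> idempotents S"
proof -
  have "star S s \<cdot> s \<cdot> (star S s \<cdot> s) = star S s \<cdot> (s \<cdot> (star S s \<cdot> s))"
    using s by (intro mult_assoc) auto
  then show ?thesis using s by (simp add: idempotents_iff del: mult_assoc)
qed

lemma mult_star_idempotent: "s \<in> arrows S \<Longrightarrow> s \<cdot> star S s \<in> idempotents S"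
  using star_mult_idempotent [of "star S s"] by simp

lemma idempotent_mult_mult:
  assumes e: "e \<in> idempotents S" and r: "r \<in> arrows S" "tgt S r = src S e"
  shows "e \<cdot> (e \<cdot> r) = e \<cdot> r"
proof -
  have "e \<cdot> (e \<cdot> r) = e \<cdot> e \<cdot> r"
    using e r by (intro mult_assoc [symmetric]) (auto simp: idempotents_iff)
  also have "e \<cdot> e = e"
    using e by (simp add: idempotents_iff)
  finally show ?thesis .
qed

text \<open>The inverse \<open>g\<close> of \<open>e f\<close> equals \<open>f g e\<close>, since that is an inverse of \<open>e f\<close> too. This
  form makes \<open>g\<close> idempotent, hence its own inverse, so that \<open>e f = g\<close>.\<close>

lemma mult_idempotent:
  assumes e: "e \<in> idempotents S" and f: "f \<in> idempotents S" and ef: "src S e = src S f"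
  shows "e \<cdot> f \<in> idempotents S"
proof -
  have [simp]: "e \<in> arrows S" "f \<in> arrows S" "src S e = tgt S e" "src S f = tgt S e"
      "tgt S f = tgt S e" "e \<cdot> e = e" "f \<cdot> f = f"
    using e f ef unfolding idempotents_iff by metis+
  note absorb = idempotent_mult_mult [OF e] idempotent_mult_mult [OF f]
  define g where "g = star S (e \<cdot> f)"
  have g [simp]: "g \<in> arrows S" "src S g = tgt S e" "tgt S g = tgt S e"
    by (auto simp: g_def)
  have inv: "e \<cdot> (f \<cdot> (g \<cdot> (e \<cdot> f))) = e \<cdot> f" "g \<cdot> (e \<cdot> (f \<cdot> g)) = g"
    using mult_star_mult [of "e \<cdot> f"] by (auto simp flip: g_def)
  have gef: "g \<cdot> (e \<cdot> (f \<cdot> (g \<cdot> r))) = g \<cdot> r" if "r \<in> arrows S" "tgt S r = tgt S e" for r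
  proof -
    have "g \<cdot> (e \<cdot> (f \<cdot> (g \<cdot> r))) = g \<cdot> (e \<cdot> (f \<cdot> g)) \<cdot> r"
      using that by simp
    then show ?thesis by (simp only: inv)
  qed
  have "is_inverse S (e \<cdot> f) (f \<cdot> (g \<cdot> e))"
    by (simp add: is_inverse_def composable_iff absorb inv gef)
  then have g_eq: "f \<cdot> (g \<cdot> e) = g"
    unfolding g_def by (rule star_eqI [symmetric])
  have "g \<cdot> g = f \<cdot> (g \<cdot> e) \<cdot> (f \<cdot> (g \<cdot> e))"
    by (simp only: g_eq)
  also have "\<dots> = f \<cdot> (g \<cdot> e)"
    by (simp add: gef)
  finally have "g \<in> idempotents S"
    by (simp add: idempotents_iff g_eq)
  moreover have "star S g = e \<cdot> f"
    by (simp add: g_def)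
  ultimately show ?thesis
    using star_idempotent by metis
qed

lemma idempotents_commute:
  assumes e: "e \<in> idempotents S" and f: "f \<in> idempotents S" and ef: "src S e = src S f"
  shows "e \<cdot> f = f \<cdot> e"
proof -
  have [simp]: "e \<in> arrows S" "f \<in> arrows S" "src S e = tgt S e" "src S f = tgt S e"
      "tgt S f = tgt S e" "e \<cdot> e = e" "f \<cdot> f = f"
    using e f ef unfolding idempotents_iff by metis+
  note absorb = idempotent_mult_mult [OF e] idempotent_mult_mult [OF f]
  have idem: "e \<cdot> f \<in> idempotents S" "f \<cdot> e \<in> idempotents S"
    using mult_idempotent e f ef by auto
  then have "e \<cdot> (f \<cdot> (e \<cdot> f)) = e \<cdot> f" "f \<cdot> (e \<cdot> (f \<cdot> e)) = f \<cdot> e"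
    by (auto simp: idempotents_iff)
  \<comment> \<open>Both \<open>e f\<close> itself and \<open>f e\<close> are inverses of the idempotent \<open>e f\<close>.\<close>
  then have "is_inverse S (e \<cdot> f) (f \<cdot> e)"
    by (simp add: is_inverse_def composable_iff absorb)
  then show ?thesis
    using star_eqI star_idempotent idem(1) by metis
qed

text \<open>The idempotents \<open>t t\<^sup>*\<close> and \<open>s\<^sup>* s\<close> that meet in the middle of \<open>s t t\<^sup>* s\<^sup>* s t\<close> commute.\<close>

lemma star_mult:
  assumes [simp]: "s \<in> arrows S" "t \<in> arrows S" "src S s = tgt S t"
  shows "star S (s \<cdot> t) = star S t \<cdot> star S s"
proof (rule star_eqI)
  have comm: "t \<cdot> star S t \<cdot> (star S s \<cdot> s) = star S s \<cdot> s \<cdot> (t \<cdot> star S t)"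
    by (intro idempotents_commute mult_star_idempotent star_mult_idempotent) simp_all
  have "s \<cdot> t \<cdot> (star S t \<cdot> star S s) \<cdot> (s \<cdot> t) = s \<cdot> (t \<cdot> star S t \<cdot> (star S s \<cdot> s)) \<cdot> t"
    by simp
  also have "\<dots> = s \<cdot> (star S s \<cdot> s) \<cdot> (t \<cdot> (star S t \<cdot> t))"
    unfolding comm by (simp del: mult_star_mult)
  also have "\<dots> = s \<cdot> t"
    by (simp del: mult_assoc)
  finally have 1: "s \<cdot> t \<cdot> (star S t \<cdot> star S s) \<cdot> (s \<cdot> t) = s \<cdot> t" .
  have "star S t \<cdot> star S s \<cdot> (s \<cdot> t) \<cdot> (star S t \<cdot> star S s)
      = star S t \<cdot> (star S s \<cdot> s \<cdot> (t \<cdot> star S t)) \<cdot> star S s"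
    by simp
  also have "\<dots> = star S t \<cdot> (t \<cdot> star S t) \<cdot> (star S s \<cdot> (s \<cdot> star S s))"
    unfolding comm [symmetric] by (simp del: mult_star_mult)
  also have "\<dots> = star S t \<cdot> star S s"
    by (simp del: mult_assoc)
  finally show "is_inverse S (s \<cdot> t) (star S t \<cdot> star S s)"
    using 1 by (simp add: is_inverse_def composable_iff del: mult_assoc)
qed


section \<open>Partial and global actions\<close>

lemma region_subset_points: "S_set S X \<Longrightarrow> s \<in> arrows S \<Longrightarrow> x \<in> region X s \<Longrightarrow> x \<in> points X"
  by (auto simp: S_set_def)

lemma act_closed: "S_set S X \<Longrightarrow> s \<in> arrows S \<Longrightarrow> x \<in> region X (star S s) \<Longrightarrow> act X s x \<in> region X s"
  by (auto simp: S_set_def)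

lemma act_idempotent: "S_set S X \<Longrightarrow> e \<in> idempotents S \<Longrightarrow> x \<in> region X e \<Longrightarrow> act X e x = x"
  by (simp add: S_set_def)

lemma act_mult:
  assumes X: "S_set S X" and s: "s \<in> arrows S" and t: "t \<in> arrows S" and st: "src S s = tgt S t"
    and x: "x \<in> region X (star S t)"
  shows "x \<in> region X (star S (s \<cdot> t)) \<longleftrightarrow> act X t x \<in> region X (star S s)"
    and "x \<in> region X (star S (s \<cdot> t)) \<Longrightarrow> act X (s \<cdot> t) x = act X s (act X t x)"
proof -
  have "(s, t) \<in> composable S"
    using s t st by (simp add: composable_iff)
  then have eq: "{x \<in> region X (star S t). act X t x \<in> region X t \<inter> region X (star S s)}
          = region X (star S (s \<cdot> t)) \<inter> region X (star S t)"
    and act: "\<forall>x \<in> region X (star S (s \<cdot> t)) \<inter> region X (star S t).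
           act X s (act X t x) = act X (s \<cdot> t) x"
    using X unfolding S_set_def by auto
  show "x \<in> region X (star S (s \<cdot> t)) \<longleftrightarrow> act X t x \<in> region X (star S s)"
    using eq x act_closed [OF X t x] by auto
  show "x \<in> region X (star S (s \<cdot> t)) \<Longrightarrow> act X (s \<cdot> t) x = act X s (act X t x)"
    using act x by simp
qed

lemma act_act_star:
  assumes X: "S_set S X" and s: "s \<in> arrows S" and x: "x \<in> region X s"
  shows "act X s (act X (star S s) x) = x"
proof -
  have "act X (star S s) x \<in> region X (star S s)"
    using act_closed [OF X, of "star S s" x] s x by simp
  then have "x \<in> region X (star S (s \<cdot> star S s))"
      "act X (s \<cdot> star S s) x = act X s (act X (star S s) x)"
    using act_mult [OF X s, of "star S s" x] s x by auto
  moreover have "s \<cdot> star S s \<in> idempotents S"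
    using s by (rule mult_star_idempotent)
  ultimately show ?thesis
    using act_idempotent [OF X] star_idempotent by metis
qed

lemma global_region_star_mult:
  assumes "global_S_set S Z" "s \<in> arrows S"
  shows "region Z (star S s \<cdot> s) = region Z (star S s)"
  using assms star_star star_closed(1) unfolding global_S_set_def by metis

end


section \<open>The spread of a pair in a globalization\<close>

locale globalization_loc = inverse_semigroupoid_loc +
  fixes X :: "('s, 'x, 'n) action_data_scheme"
    and Z :: "('s, 'z, 'k) action_data_scheme"
    and j :: "'x \<Rightarrow> 'z"
  assumes X: "S_set S X"
    and glob: "globalization S X j Z"
begin

definition spread :: "'s \<times> 'x \<Rightarrow> 'z" where
  "spread = (\<lambda>(s, x). act Z s (j x))"

lemma Z_global: "global_S_set S Z"
  using glob by (simp add: globalization_def)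

lemma Z: "S_set S Z"
  using Z_global unfolding global_S_set_def by blast

lemma embedding_j: "embedding S X Z j"
  using glob by (simp add: globalization_def)

lemma S_function_j: "S_function S X Z j"
  using embedding_j unfolding embedding_def by blast

lemma inj_j: "inj_on j (points X)"
  using embedding_j unfolding embedding_def by blast

lemma embedding_region:
  "s \<in> arrows S \<Longrightarrow>
     region X s = {x \<in> points X. j x \<in> act Z s ` (j ` points X \<inter> region Z (star S s))}"
  using embedding_j unfolding embedding_def by blast

lemma j_region: "s \<in> arrows S \<Longrightarrow> x \<in> region X s \<Longrightarrow> j x \<in> region Z s"
  using S_function_j unfolding S_function_def by blast

lemma j_act: "s \<in> arrows S \<Longrightarrow> x \<in> region X (star S s) \<Longrightarrow> j (act X s x) = act Z s (j x)"
  using S_function_j unfolding S_function_def by blast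

lemma D_set_iff: "(s, x) \<in> D_set S X \<longleftrightarrow> s \<in> arrows S \<and> x \<in> region X (star S s \<cdot> s)"
  by (simp add: D_set_def)

lemma D_set_points:
  assumes "(s, x) \<in> D_set S X" shows "x \<in> points X"
  using assms region_subset_points [OF X, of "star S s \<cdot> s" x] by (auto simp: D_set_iff)

text \<open>The idempotent \<open>s\<^sup>* s\<close> acts on \<open>x\<close>, but \<open>s\<close> itself need not. It does act on \<open>j x\<close>,
  because the action on \<open>Z\<close> is global.\<close>

lemma j_D_set:
  assumes "(s, x) \<in> D_set S X" shows "j x \<in> region Z (star S s)"
  using assms j_region [of "star S s \<cdot> s" x] global_region_star_mult [OF Z_global, of s]
  by (auto simp: D_set_iff)

text \<open>This is where the condition on regions in the definition of an embedding enters: if \<open>s\<close>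
  moves one point of the image of \<open>j\<close> to another one in \<open>Z\<close>, it does so already in \<open>X\<close>.\<close>

lemma act_reflected:
  assumes s: "s \<in> arrows S" and x: "x \<in> points X" and y: "y \<in> points X"
    and jx: "j x \<in> region Z (star S s)" and eq: "act Z s (j x) = j y"
  shows "x \<in> region X (star S s)" "act X s x = y"
proof -
  have jy: "j y \<in> region Z s"
    using act_closed [OF Z s jx] eq by simp
  \<comment> \<open>The condition for \<open>x \<in> region X (star S s)\<close> is that \<open>star S s\<close> reaches \<open>j x\<close> from the image
    of \<open>j\<close>: it does so from \<open>j y\<close>.\<close>
  have "act Z (star S s) (j y) = j x"
    using act_act_star [OF Z, of "star S s" "j x"] s jx eq by simp
  then have "j x \<in> act Z (star S s) ` (j ` points X \<inter> region Z (star S (star S s)))"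
    using y jy s by (auto intro: image_eqI [of _ _ "j y"])
  moreover have "region X (star S s) = {x \<in> points X. j x \<in>
      act Z (star S s) ` (j ` points X \<inter> region Z (star S (star S s)))}"
    using s by (intro embedding_region) simp
  ultimately show xs: "x \<in> region X (star S s)"
    using x by simp
  have "j (act X s x) = j y"
    using j_act [OF s xs] eq by simp
  moreover have "act X s x \<in> points X"
    using region_subset_points [OF X s] act_closed [OF X s xs] by simp
  ultimately show "act X s x = y"
    using inj_j y by (simp add: inj_on_eq_iff)
qed

text \<open>Under (R1), \<open>t\<^sup>* s\<close> moves \<open>j x\<close> to \<open>j y\<close>; in \<open>Z\<close> this factors as \<open>s\<close> followed by \<open>t\<^sup>*\<close>, and
  acting with \<open>t\<close> undoes the second factor. Under (R2) both arrows act as identities.\<close>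

lemma spread_eq_of_D_sim:
  assumes "(a, b) \<in> D_sim S X"
  shows "spread a = spread b"
proof -
  obtain s x t y where ab: "a = (s, x)" "b = (t, y)"
    by (metis surj_pair)
  have D: "(s, x) \<in> D_set S X" "(t, y) \<in> D_set S X"
    using assms by (auto simp: D_sim_def ab)
  have st: "s \<in> arrows S" "t \<in> arrows S"
    using D by (auto simp: D_set_iff)
  consider (R1) "(star S t, s) \<in> composable S" "x \<in> region X (star S s \<cdot> t)"
      "act X (star S t \<cdot> s) x = y"
    | (R2) "s \<in> idempotents S" "t \<in> idempotents S" "x = y"
    using assms by (auto simp: D_sim_def ab)
  then show ?thesis
  proof cases
    case R1
    have tgt: "tgt S s = tgt S t"
      using R1 st by (simp add: composable_iff)
    then have star: "star S (star S t \<cdot> s) = star S s \<cdot> t"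
      using st by (simp add: star_mult)
    have x: "x \<in> region X (star S (star S t \<cdot> s))"
      using R1 star by simp
    have jx: "j x \<in> region Z (star S (star S t \<cdot> s))"
      using j_region [of "star S s \<cdot> t" x] R1(2) star st tgt by simp
    have "j y = act Z (star S t) (act Z s (j x))" "act Z s (j x) \<in> region Z t"
      using act_mult [OF Z _ _ _ j_D_set [OF D(1)], of "star S t"] jx j_act [OF _ x] R1(3) st tgt
      by auto
    then show ?thesis
      using act_act_star [OF Z st(2)] by (simp add: spread_def ab)
  next
    case R2
    have "act Z e (j z) = j z" if "e \<in> idempotents S" "(e, z) \<in> D_set S X" for e z
      using act_idempotent [OF Z that(1)] j_D_set [OF that(2)] star_idempotent [OF that(1)] by simp
    then show ?thesis
      using R2 D by (simp add: spread_def ab)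
  qed
qed

lemma equiv_D_equiv: "equiv (D_set S X) (D_equiv S X)"
proof -
  let ?F = "{R. equiv (D_set S X) R \<and> D_sim S X \<subseteq> R}"
  have "equiv (D_set S X) (D_set S X \<times> D_set S X)"
    by (auto simp: equiv_def refl_on_def sym_on_def trans_on_def)
  moreover have "D_sim S X \<subseteq> D_set S X \<times> D_set S X"
    by (auto simp: D_sim_def)
  ultimately have top: "D_set S X \<times> D_set S X \<in> ?F"
    by simp
  have F: "R \<subseteq> D_set S X \<times> D_set S X" "refl_on (D_set S X) R" "sym R" "trans R" if "R \<in> ?F" for R
    using that by (auto elim: equivE)
  have "D_equiv S X \<subseteq> D_set S X \<times> D_set S X"
    unfolding D_equiv_def using top by (rule Inter_lower)
  moreover have "refl_on (D_set S X) (D_equiv S X)"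
    unfolding D_equiv_def using F(2) by (intro refl_onI InterI) (meson refl_onD)
  moreover have "sym (D_equiv S X)"
    unfolding D_equiv_def using F(3) by (intro symI InterI) (meson InterD symD)
  moreover have "trans (D_equiv S X)"
    unfolding D_equiv_def using F(4) by (intro transI InterI) (meson InterD transD)
  ultimately show ?thesis
    by (intro equivI)
qed

lemma D_sim_subset_D_equiv: "D_sim S X \<subseteq> D_equiv S X"
  by (auto simp: D_equiv_def)

lemma D_class_eq_iff:
  assumes "a \<in> D_set S X" "b \<in> D_set S X"
  shows "D_class S X a = D_class S X b \<longleftrightarrow> (a, b) \<in> D_equiv S X"
  unfolding D_class_def using eq_equiv_class_iff [OF equiv_D_equiv assms] .

lemma spread_eq_of_D_equiv:
  assumes "(a, b) \<in> D_equiv S X" shows "spread a = spread b"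
proof -
  let ?K = "{(a, b). a \<in> D_set S X \<and> b \<in> D_set S X \<and> spread a = spread b}"
  have "equiv (D_set S X) ?K"
    by (auto simp: equiv_def refl_on_def sym_on_def trans_on_def)
  moreover have "D_sim S X \<subseteq> ?K"
    using spread_eq_of_D_sim by (auto simp: D_sim_def)
  ultimately have "D_equiv S X \<subseteq> ?K"
    unfolding D_equiv_def by blast
  then show ?thesis
    using assms by auto
qed

text \<open>A common spread \<open>w\<close> is moved to \<open>j y\<close> by \<open>t\<^sup>*\<close>. Equality of codomains makes \<open>t\<^sup>* s\<close> exist,
  and it moves \<open>j x\<close> through \<open>w\<close> to \<open>j y\<close>.\<close>

lemma D_equiv_of_spread_eq:
  assumes sx: "(s, x) \<in> D_set S X" and ty: "(t, y) \<in> D_set S X"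
    and tgt: "tgt S s = tgt S t" and eq: "spread (s, x) = spread (t, y)"
  shows "((s, x), (t, y)) \<in> D_equiv S X"
proof -
  have st [simp]: "s \<in> arrows S" "t \<in> arrows S"
    using sx ty by (auto simp: D_set_iff)
  have w: "act Z s (j x) = act Z t (j y)"
    using eq by (simp add: spread_def)
  have "act Z s (j x) \<in> region Z t"
    using act_closed [OF Z, of t "j y"] j_D_set [OF ty] w by simp
  moreover have "act Z (star S t) (act Z t (j y)) = j y"
    using act_act_star [OF Z, of "star S t" "j y"] j_D_set [OF ty] by simp
  ultimately have jx: "j x \<in> region Z (star S (star S t \<cdot> s))"
      and jy: "act Z (star S t \<cdot> s) (j x) = j y"
    using act_mult [OF Z _ _ _ j_D_set [OF sx], of "star S t"] tgt w by auto
  have "x \<in> region X (star S (star S t \<cdot> s))" "act X (star S t \<cdot> s) x = y"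
    using act_reflected [OF _ D_set_points [OF sx] D_set_points [OF ty] jx jy] tgt by auto
  then have "((s, x), (t, y)) \<in> D_sim S X"
    using sx ty tgt by (simp add: D_sim_def composable_iff star_mult)
  then show ?thesis
    using D_sim_subset_D_equiv by auto
qed


section \<open>The mediating function on representatives\<close>

lemma univ_incl_eq:
  assumes e: "e \<in> idempotents S" and x: "x \<in> region X e"
  shows "univ_incl S X x = D_class S X (e, x)"
  unfolding univ_incl_def
proof (rule the_equality)
  show "\<exists>f\<in>idempotents S. x \<in> region X f \<and> D_class S X (e, x) = D_class S X (f, x)"
    using e x by auto
next
  have D: "(f, x) \<in> D_set S X" if "f \<in> idempotents S" "x \<in> region X f" for f
    using that star_idempotent [OF that(1)] by (simp add: D_set_iff idempotents_iff)
  fix a assume "\<exists>f\<in>idempotents S. x \<in> region X f \<and> a = D_class S X (f, x)"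
  then obtain f where f: "f \<in> idempotents S" "x \<in> region X f" "a = D_class S X (f, x)"
    by auto
  have "((f, x), (e, x)) \<in> D_sim S X"
    using D [OF f(1,2)] D [OF e x] f(1) e by (simp add: D_sim_def)
  then show "a = D_class S X (e, x)"
    using D_sim_subset_D_equiv D_class_eq_iff [OF D [OF f(1,2)] D [OF e x]] f(3) by auto
qed

lemma D_starD:
  assumes "(p, x) \<in> D_star S X s"
  shows "(p, x) \<in> D_set S X" "s \<in> arrows S" "p \<in> arrows S" "src S s = tgt S p"
    "(s \<cdot> p, x) \<in> D_set S X"
  using assms by (auto simp: D_star_def D_set_iff composable_iff star_mult)

lemma spread_mult:
  assumes "(p, x) \<in> D_star S X s"
  shows "spread (s \<cdot> p, x) = act Z s (spread (p, x))"
proof -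
  note p = D_starD [OF assms]
  show ?thesis
    using act_mult(2) [OF Z p(2-4) j_D_set [OF p(1)] j_D_set [OF p(5)]] by (simp add: spread_def)
qed

text \<open>This is the well-definedness of \<open>\<eta>\<^sub>s\<close>. Two representatives of one class may have
  different codomains, but those to which \<open>\<eta>\<^sub>s\<close> applies become, after multiplication by \<open>s\<close>,
  pairs with the codomain of \<open>s\<close>, and such pairs are classified by their spread.\<close>

lemma act_univ_glob:
  assumes px: "(p, x) \<in> D_star S X s"
  shows "act (univ_glob S X) s (D_class S X (p, x)) = D_class S X (s \<cdot> p, x)"
proof -
  have unique: "b = D_class S X (s \<cdot> p, x)"
    if qy: "(q, y) \<in> D_star S X s" and cl: "D_class S X (p, x) = D_class S X (q, y)"
      and b: "b = D_class S X (s \<cdot> q, y)" for q y b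
  proof -
    note P = D_starD [OF px] and Q = D_starD [OF qy]
    have "spread (p, x) = spread (q, y)"
      using cl D_class_eq_iff P(1) Q(1) spread_eq_of_D_equiv by blast
    then have "spread (s \<cdot> p, x) = spread (s \<cdot> q, y)"
      using spread_mult px qy by simp
    then have "((s \<cdot> p, x), (s \<cdot> q, y)) \<in> D_equiv S X"
      using P Q by (intro D_equiv_of_spread_eq) auto
    then show ?thesis
      using b D_class_eq_iff [OF P(5) Q(5)] by simp
  qed
  have "act (univ_glob S X) s (D_class S X (p, x)) = (THE b. \<exists>q y. (q, y) \<in> D_star S X s \<and>
      D_class S X (p, x) = D_class S X (q, y) \<and> b = D_class S X (s \<cdot> q, y))"
    by (simp add: univ_glob_def)
  also have "\<dots> = D_class S X (s \<cdot> p, x)"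
    using px unique by (intro the_equality) blast+
  finally show ?thesis .
qed

lemma mediating_function_D_class:
  assumes \<sigma>: "mediating_function S X (univ_incl S X) (univ_glob S X) j Z \<sigma>"
    and sx: "(s, x) \<in> D_set S X"
  shows "\<sigma> (D_class S X (s, x)) = spread (s, x)"
proof -
  let ?e = "star S s \<cdot> s"
  have s: "s \<in> arrows S" and x: "x \<in> region X ?e"
    using sx by (auto simp: D_set_iff)
  have e: "?e \<in> idempotents S"
    using s by (rule star_mult_idempotent)
  have ex: "(?e, x) \<in> D_star S X s"
  proof -
    have "star S ?e \<cdot> star S s \<cdot> s \<cdot> ?e = ?e" "star S ?e \<cdot> ?e = ?e"
      using s by (simp_all add: star_idempotent [OF e])
    then show ?thesis
      using s x by (simp add: D_star_def D_set_iff composable_iff del: mult_assoc)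
  qed
  have "D_class S X (?e, x) \<in> region (univ_glob S X) (star S s)"
    using ex s by (simp add: univ_glob_def)
  then have "\<sigma> (act (univ_glob S X) s (D_class S X (?e, x))) = act Z s (\<sigma> (D_class S X (?e, x)))"
    using \<sigma> s by (simp add: mediating_function_def S_function_def)
  moreover have "act (univ_glob S X) s (D_class S X (?e, x)) = D_class S X (s, x)"
    using act_univ_glob [OF ex] s by simp
  moreover have "\<sigma> (D_class S X (?e, x)) = j x"
    using \<sigma> D_set_points [OF sx] unfolding mediating_function_def univ_incl_eq [OF e x, symmetric]
    by blast
  ultimately show ?thesis
    by (simp add: spread_def)
qed

end


section \<open>Injectivity on fibres\<close>

theorem proposition3p17:
  fixes S :: "('s, 'o) semigroupoid"
    and X :: "('s, 'x) action_data"
    and Z :: "('s, 'z) action_data"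
    and j :: "'x \<Rightarrow> 'z"
    and \<sigma> :: "('s \<times> 'x) set \<Rightarrow> 'z"
    and u :: 'o
  assumes "inverse_semigroupoid S"
    and "S_set S X"
    and "globalization S X j Z"
    and "mediating_function S X (univ_incl S X) (univ_glob S X) j Z \<sigma>"
    and "u \<in> objects S"
  shows "inj_on \<sigma> (univ_fibre S X u)"
proof -
  interpret globalization_loc S X Z j
    using assms by unfold_locales
  show ?thesis
  proof (rule inj_onI)
    fix a b assume "a \<in> univ_fibre S X u" "b \<in> univ_fibre S X u" and eq: "\<sigma> a = \<sigma> b"
    then obtain s x t y where
      a: "a = D_class S X (s, x)" "(s, x) \<in> D_set S X" "tgt S s = u" and
      b: "b = D_class S X (t, y)" "(t, y) \<in> D_set S X" "tgt S t = u"
      unfolding univ_fibre_def by auto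
    then have "spread (s, x) = spread (t, y)"
      using eq mediating_function_D_class [OF assms(4)] by simp
    then show "a = b"
      using D_equiv_of_spread_eq D_class_eq_iff a b by simp
  qed
qed

end
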